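(* Let $A$ be an $n\times n$ consensus matrix, let $i,j\in\{1,\dots,n\}$, and let $B_i=e_i$ and $C_j=e_j^{\mathsf T}$. Then the system $(A,B_i,C_j)$ is left-invertible.
   Context: A consensus matrix is a real square matrix that is row stochastic (nonnegative entries, rows summing to one) and primitive. $e_i$ is the $i$-th canonical basis vector of $\mathbb{R}^n$. The system $(A,B,C)$ with $m$ inputs denotes $x(t+1)=Ax(t)+Bu(t)$, $y(t)=Cx(t)$. It is left-invertible if the pencil $P(z)=\begin{bmatrix} zI-A & B\\ C&0\end{bmatrix}$ has rank $n+m$ for all but finitely many $z\in\mathbb{C}$; equivalently, starting from any initial condition, no two distinct input sequences give rise to the same output sequence. *)

theory Defs
  imports "HOL-Analysis.Analysis"
begin

(* The operators * and ^ on type vec act componentwise, so powers with respect to the matrix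
   product ** need their own definition. *)
primrec matrix_power :: "'a::semiring_1^'n^'n \<Rightarrow> nat \<Rightarrow> 'a^'n^'n" where
  "matrix_power A 0 = mat 1"
| "matrix_power A (Suc k) = A ** matrix_power A k"

definition nonneg_matrix :: "real^'n^'m \<Rightarrow> bool" where
  "nonneg_matrix A \<longleftrightarrow> (\<forall>i j. A $ i $ j \<ge> 0)"

definition row_stochastic :: "real^'n^'n \<Rightarrow> bool" where
  "row_stochastic A \<longleftrightarrow> nonneg_matrix A \<and> (\<forall>i. (\<Sum>j\<in>UNIV. A $ i $ j) = 1)"

definition primitive_matrix :: "real^'n^'n \<Rightarrow> bool" where
  "primitive_matrix A \<longleftrightarrow> nonneg_matrix A \<and> (\<exists>k>0. \<forall>i j. matrix_power A k $ i $ j > 0)"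

definition consensus_matrix :: "real^'n^'n \<Rightarrow> bool" where
  "consensus_matrix A \<longleftrightarrow> row_stochastic A \<and> primitive_matrix A"

definition block_matrix ::
  "'a^'n^'k \<Rightarrow> 'a^'m^'k \<Rightarrow> 'a^'n^'l \<Rightarrow> 'a^'m^'l \<Rightarrow> 'a^('n + 'm)^('k + 'l)" where
  "block_matrix P Q R S = (\<chi> r c.
     case r of
       Inl k \<Rightarrow> (case c of Inl n \<Rightarrow> P $ k $ n | Inr m \<Rightarrow> Q $ k $ m)
     | Inr l \<Rightarrow> (case c of Inl n \<Rightarrow> R $ l $ n | Inr m \<Rightarrow> S $ l $ m))"

(* State dimension CARD('n), m = CARD('m) inputs, CARD('p) outputs. *)
definition system_pencil ::
  "real^'n^'n \<Rightarrow> real^'m^'n \<Rightarrow> real^'n^'p \<Rightarrow> complex \<Rightarrow> complex^('n + 'm)^('n + 'p)" where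
  "system_pencil A B C z =
     block_matrix (mat z - map_matrix of_real A) (map_matrix of_real B)
                  (map_matrix of_real C)         0"

definition left_invertible_system ::
  "real^'n^'n \<Rightarrow> real^'m^'n \<Rightarrow> real^'n^'p \<Rightarrow> bool" where
  "left_invertible_system A B C \<longleftrightarrow>
     finite {z. rank (system_pencil A B C z) \<noteq> CARD('n) + CARD('m)}"

end

(* The pencil is square and its determinant is a polynomial in z, so a single z with trivial kernel
   suffices. At z = 2 a real kernel vector satisfies 2x + u e_i = Ax and x_j = 0; choosing its sign
   so that u <= 0, the minimum principle for A gives x >= 0, whence Ax <= 2x and, inductively,
   A^k x <= 2^k x. Evaluating at j, where x vanishes, for a positive power A^k gives x = 0. *)
theory Submission
  imports Defs "HOL-Computational_Algebra.Polynomial"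
begin

lemma poly_det:
  fixes M :: "'a::comm_ring_1 poly^'n^'n"
  shows "poly (det M) z = det (map_matrix (\<lambda>p. poly p z) M)"
  by (simp add: det_def poly_sum poly_prod)

text \<open>Full row rank means that the rows span the whole space, which amounts to a left inverse,
  hence to invertibility.\<close>

lemma full_rank_iff_det_nonzero:
  fixes M :: "'a::field^'n^'n"
  shows "rank M = CARD('n) \<longleftrightarrow> det M \<noteq> 0"
proof -
  have "rank M = CARD('n) \<longleftrightarrow> vec.span (rows M) = UNIV"
    unfolding row_rank_def_gen by (metis vec.dim_eq_full vec_dim_card vec.dimension_def vec.dim_UNIV)
  then show ?thesis
    using matrix_left_invertible_span_rows_gen[of M]
    by (auto simp: invertible_det_nz[symmetric] invertible_left_inverse)
qed

text \<open>The rank drops exactly at the roots of the polynomial \<open>det M\<close>. The trivial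
  kernel at \<open>w\<close> makes that polynomial nonzero, so its roots are finite in
  number.\<close>

lemma finite_rank_drop:
  fixes M :: "'a::field poly^'n^'n"
  assumes "\<And>x. map_matrix (\<lambda>p. poly p w) M *v x = 0 \<Longrightarrow> x = 0"
  shows "finite {z. rank (map_matrix (\<lambda>p. poly p z) M) \<noteq> CARD('n)}"
proof -
  have "invertible (map_matrix (\<lambda>p. poly p w) M)"
    using assms matrix_left_invertible_ker invertible_left_inverse by blast
  then have "poly (det M) w \<noteq> 0"
    by (simp add: poly_det invertible_det_nz)
  then have "finite {z. poly (det M) z = 0}"
    by (intro poly_roots_finite) auto
  then show ?thesis
    by (simp add: full_rank_iff_det_nonzero poly_det)
qed

lemma sum_UNIV_Plus:
  fixes f :: "'a::finite + 'b::finite \<Rightarrow> 'c::comm_monoid_add"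
  shows "sum f UNIV = (\<Sum>a\<in>UNIV. f (Inl a)) + (\<Sum>b\<in>UNIV. f (Inr b))"
  using sum.Plus[of "UNIV :: 'a set" "UNIV :: 'b set" f] by simp

lemma system_pencil_mult_Inl:
  "(system_pencil A B C z *v x) $ Inl k =
     z * x $ Inl k - (\<Sum>l\<in>UNIV. of_real (A $ k $ l) * x $ Inl l)
       + (\<Sum>m\<in>UNIV. of_real (B $ k $ m) * x $ Inr m)"
proof -
  have "(\<Sum>l\<in>UNIV. (mat z :: complex^'a^'a) $ k $ l * x $ Inl l) = z * x $ Inl k"
    \<comment> \<open>Moving the product inside the \<open>if\<close> lets the sum collapse to its
      diagonal term.\<close>
    by (simp add: mat_def if_distrib[of "\<lambda>c. c * _"] cong: if_cong)
  then show ?thesis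
    by (simp add: system_pencil_def block_matrix_def matrix_vector_mult_def sum_UNIV_Plus
        left_diff_distrib sum_subtractf)
qed

lemma system_pencil_mult_Inr:
  "(system_pencil A B C z *v x) $ Inr k = (\<Sum>l\<in>UNIV. of_real (C $ k $ l) * x $ Inl l)"
  by (simp add: system_pencil_def block_matrix_def matrix_vector_mult_def sum_UNIV_Plus)

lemma system_pencil_eq_map_poly:
  obtains M where "\<And>z. system_pencil A B C z = map_matrix (\<lambda>p. poly p z) M"
proof
  show "system_pencil A B C z = map_matrix (\<lambda>p. poly p z)
      (block_matrix (mat [:0, 1:] - map_matrix (\<lambda>a. [:of_real a:]) A)
        (map_matrix (\<lambda>b. [:of_real b:]) B) (map_matrix (\<lambda>c. [:of_real c:]) C) 0)" for z
    by (auto simp: vec_eq_iff system_pencil_def block_matrix_def mat_def split: sum.splits)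
qed

text \<open>Minimum principle: at an index \<open>l\<close> of the least entry, row \<open>l\<close>
  of \<open>A\<close> averages values that are at least \<open>x $ l\<close>, so
  \<open>x $ l\<close> is at most twice itself and cannot be negative.\<close>

lemma row_stochastic_nonneg_if_le_two:
  assumes A: "row_stochastic A" and x: "\<And>k. (A *v x) $ k \<le> 2 * x $ k"
  shows "x $ k \<ge> 0"
proof -
  obtain l where l: "\<And>k. x $ l \<le> x $ k"
    using ex_is_arg_min_if_finite[of UNIV "\<lambda>k. x $ k"] by (auto simp: is_arg_min_linorder)
  have "x $ l = (\<Sum>k\<in>UNIV. A $ l $ k * x $ l)"
    using A by (simp add: row_stochastic_def flip: sum_distrib_right)
  also have "\<dots> \<le> (A *v x) $ l"
    using A l unfolding matrix_vector_mult_def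
    by (auto simp: row_stochastic_def nonneg_matrix_def
        intro!: sum_mono mult_left_mono)
  also have "\<dots> \<le> 2 * x $ l"
    by (rule x)
  finally show ?thesis
    using l[of k] by simp
qed

text \<open>A nonnegative matrix preserves entrywise inequalities, so the bound can be multiplied by
  \<open>A\<close> again and again.\<close>

lemma matrix_power_mult_le:
  assumes A: "nonneg_matrix A" and "c \<ge> 0" and x: "\<And>k. (A *v x) $ k \<le> c * x $ k"
  shows "(matrix_power A n *v x) $ k \<le> c ^ n * x $ k"
proof (induction n arbitrary: k)
  case 0
  then show ?case by simp
next
  case (Suc n)
  have "(matrix_power A (Suc n) *v x) $ k = (\<Sum>l\<in>UNIV. A $ k $ l * (matrix_power A n *v x) $ l)"
    by (simp add: matrix_vector_mul_assoc[symmetric]) (simp add: matrix_vector_mult_def)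
  also have "\<dots> \<le> (\<Sum>l\<in>UNIV. A $ k $ l * (c ^ n * x $ l))"
    using A Suc.IH by (intro sum_mono mult_left_mono) (auto simp: nonneg_matrix_def)
  also have "\<dots> = c ^ n * (A *v x) $ k"
    by (simp add: matrix_vector_mult_def sum_distrib_left mult_ac)
  also have "\<dots> \<le> c ^ n * (c * x $ k)"
    using \<open>c \<ge> 0\<close> x by (intro mult_left_mono) auto
  finally show ?case by (simp add: mult_ac)
qed

lemma consensus_matrix_zero_if_le_two:
  assumes A: "consensus_matrix A" and x: "\<And>k. (A *v x) $ k \<le> 2 * x $ k" and j: "x $ j = 0"
  shows "x = 0"
proof -
  have nonneg: "x $ k \<ge> 0" for k
    using A x by (auto simp: consensus_matrix_def intro: row_stochastic_nonneg_if_le_two)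
  obtain n where n: "\<And>k l. matrix_power A n $ k $ l > 0"
    using A by (auto simp: consensus_matrix_def primitive_matrix_def)
  have "(matrix_power A n *v x) $ j \<le> 2 ^ n * x $ j"
    using A x by (intro matrix_power_mult_le) (auto simp: consensus_matrix_def primitive_matrix_def)
  \<comment> \<open>Since x vanishes at \<open>j\<close>, a sum of nonnegative terms is bounded by
    0. Every term is then 0, and the positive weights of the matrix power force x = 0.\<close>
  then have "(\<Sum>l\<in>UNIV. matrix_power A n $ j $ l * x $ l) \<le> 0"
    by (simp add: j matrix_vector_mult_def)
  moreover have summand: "matrix_power A n $ j $ l * x $ l \<ge> 0" for l
    using n nonneg by (simp add: less_imp_le)
  ultimately have "(\<Sum>l\<in>UNIV. matrix_power A n $ j $ l * x $ l) = 0"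
    by (simp add: order_antisym sum_nonneg)
  then have "matrix_power A n $ j $ l * x $ l = 0" for l
    using summand by (simp add: sum_nonneg_eq_0_iff)
  then show ?thesis
    using n by (simp add: vec_eq_iff) (metis less_irrefl)
qed

text \<open>The equation says that 2x - Ax is -u times a basis vector, so the sign of
  \<open>u\<close> decides whether x or -x satisfies the inequality of the previous lemma.\<close>

lemma consensus_matrix_real_kernel:
  assumes A: "consensus_matrix A" and x: "\<And>k. 2 * x $ k - (A *v x) $ k + axis i 1 $ k * u = 0"
    and j: "x $ j = 0"
  shows "x = 0 \<and> u = 0"
proof -
  have "x = 0"
  proof (cases "u \<le> 0")
    case True
    then have "axis i 1 $ k * u \<le> 0" for k
      by (simp add: axis_def)
    then have "(A *v x) $ k \<le> 2 * x $ k" for k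
      using x[of k] by (smt (verit))
    then show ?thesis
      using A j by (intro consensus_matrix_zero_if_le_two)
  next
    case False
    then have "axis i 1 $ k * u \<ge> 0" for k
      by (simp add: axis_def)
    then have "2 * x $ k \<le> (A *v x) $ k" for k
      using x[of k] by (smt (verit))
    then have "(A *v - x) $ k \<le> 2 * (- x) $ k" for k
      by (simp add: matrix_vector_mult_def sum_negf)
    then have "- x = 0"
      using A j by (intro consensus_matrix_zero_if_le_two[where j = j]) auto
    then show ?thesis by simp
  qed
  \<comment> \<open>With x = 0, row \<open>i\<close> of the equation reduces to u = 0.\<close>
  moreover from this have "u = 0"
    using x[of i] by simp
  ultimately show ?thesis by simp
qed

text \<open>The matrices and the point 2 are real, so the real and imaginary parts of a complex
  kernel vector solve the real equations separately.\<close>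

lemma consensus_pencil_kernel:
  fixes A :: "real^'n^'n" and x :: "complex^('n + 1)"
  assumes A: "consensus_matrix A"
    and ker: "system_pencil A (columnvector (axis i 1) :: real^1^'n)
                (rowvector (axis j 1) :: real^'n^1) 2 *v x = 0"
  shows "x = 0"
proof -
  define y u where "y = (\<chi> k. x $ Inl k)" and "u = x $ Inr 1"
  have state: "2 * y $ k - (\<Sum>l\<in>UNIV. of_real (A $ k $ l) * y $ l)
      + of_real (axis i 1 $ k) * u = 0" for k
    using system_pencil_mult_Inl[of A "columnvector (axis i 1) :: real^1^'n"
        "rowvector (axis j 1) :: real^'n^1" 2 x k]
    unfolding ker by (simp add: y_def u_def columnvector_def)
  have "(\<Sum>l\<in>UNIV. of_real (axis j 1 $ l) * y $ l) = 0"
    using system_pencil_mult_Inr[of A "columnvector (axis i 1) :: real^1^'n"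
        "rowvector (axis j 1) :: real^'n^1" 2 x 1]
    unfolding ker by (simp add: y_def rowvector_def)
  then have y_j: "y $ j = 0"
    by (simp add: axis_def if_distrib[of of_real] if_distrib[of "\<lambda>c. c * _"] cong: if_cong)
  have "(\<chi> k. Re (y $ k)) = 0 \<and> Re u = 0"
    using arg_cong[OF state, of Re] y_j
    by (intro consensus_matrix_real_kernel[OF A, where i = i and j = j])
      (simp_all add: matrix_vector_mult_def)
  moreover have "(\<chi> k. Im (y $ k)) = 0 \<and> Im u = 0"
    using arg_cong[OF state, of Im] y_j
    by (intro consensus_matrix_real_kernel[OF A, where i = i and j = j])
      (simp_all add: matrix_vector_mult_def)
  ultimately have "y = 0" and "u = 0"
    by (simp_all add: vec_eq_iff complex_eq_iff)
  have "x $ s = 0" for s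
  proof (cases s)
    case (Inl k)
    then show ?thesis using \<open>y = 0\<close> by (simp add: y_def vec_eq_iff)
  next
    case (Inr b)
    \<comment> \<open>The index type \<open>1\<close> has a single element, so \<open>u\<close> is
      the only input entry.\<close>
    then show ?thesis using \<open>u = 0\<close> num1_eq1[of b] by (simp add: u_def)
  qed
  then show ?thesis
    by (simp add: vec_eq_iff)
qed

theorem theoremV1:
  fixes A :: "real^'n^'n" and i j :: 'n
  assumes "consensus_matrix A"
  shows "left_invertible_system A
           (columnvector (axis i 1) :: real^1^'n)
           (rowvector (axis j 1) :: real^'n^1)"
proof -
  obtain M where M: "\<And>z. system_pencil A (columnvector (axis i 1) :: real^1^'n)
      (rowvector (axis j 1) :: real^'n^1) z = map_matrix (\<lambda>p. poly p z) M"
    using system_pencil_eq_map_poly by blast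
  have "finite {z. rank (map_matrix (\<lambda>p. poly p z) M) \<noteq> CARD('n + 1)}"
    \<comment> \<open>The point 2 lies outside the spectrum of \<open>A\<close>; in the minimum
      principle any real number above 1 would serve as well.\<close>
    using consensus_pencil_kernel[OF assms] by (intro finite_rank_drop[of 2]) (simp flip: M)
  then show ?thesis
    by (simp add: left_invertible_system_def M)
qed

end
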